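(* A quiver may possess at most one totally proper cyclic ordering, up to wiggles. That is, if $\sigma$ and $\sigma'$ are cyclic orderings of the vertices of a quiver $Q$ such that both $(Q,\sigma)$ and $(Q,\sigma')$ are totally proper, then $(Q,\sigma)$ and $(Q,\sigma')$ are wiggle equivalent.
   Context: A quiver is a finite directed graph without loops or oriented 2-cycles; multiple arrows are allowed; vertices are labeled. Mutation $\mu_j$ of a quiver at a vertex $j$: for each path $i\to j\to k$ add an arrow $i\to k$; reverse all arrows incident to $j$; repeatedly remove oriented 2-cycles. A cyclic ordering $\sigma=(v_1,\dots,v_n)$ of the vertex set is a linear ordering considered up to cyclic shifts ("clockwise" placement on a circle). A cyclically ordered quiver (COQ) $(Q,\sigma)$ is a quiver with a cyclic ordering of its vertices. A wiggle transforms $(Q,\sigma)$ into $(Q,\sigma')$ where $\sigma'$ is obtained from $\sigma$ by interchanging two vertices that are consecutive in $\sigma$ and not adjacent in $Q$. Wiggle equivalence is the equivalence relation generated by wiggles. A path $i\to j\to k$ in $Q$ makes a right turn at $j$ if $\sigma=(\dots,i,\dots,j,\dots,k,\dots)$. A vertex $j$ is proper in $(Q,\sigma)$ if every oriented two-arrow path $i\to j\to k$ in $Q$ makes a right turn at $j$. A COQ $(Q,\sigma)$ is proper if for every vertex $j$ there is a COQ wiggle equivalent to $(Q,\sigma)$ (possibly depending on $j$) in which $j$ is proper. Let $\operatorname{In}(j)$ (resp., $\operatorname{Out}(j)$) be the set of vertices $i$ with an arrow $i\to j$ (resp., $j\to i$) in $Q$. If $j$ is proper in $(Q,\sigma)$,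 the proper mutation $\mu_j(Q,\sigma)$ is the quiver $\mu_j(Q)$ with the cyclic ordering obtained from $\sigma$ by keeping the placement of all vertices other than $j$ and moving $j$ clockwise past all the vertices in $\operatorname{Out}(j)$ (each exactly once) without passing any vertex in $\operatorname{In}(j)$ (well defined up to wiggles; for a sink or source $j$ the cyclic ordering does not change, up to wiggles). The proper mutation class of a COQ consists of all COQs obtained from it by repeated proper mutations and wiggles. A COQ is totally proper if all COQs in its proper mutation class are proper; a cyclic ordering $\sigma$ of $Q$ is totally proper if $(Q,\sigma)$ is. *)

theory Defs
  imports Main
begin

text \<open>Arrows are recorded by their multiplicities: \<open>arrows Q i j\<close> is the number of arrows
  \<open>i \<rightarrow> j\<close>.\<close>

record 'v quiver =
  verts :: "'v set"
  arrows :: "'v \<Rightarrow> 'v \<Rightarrow> nat"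

definition is_quiver :: "'v quiver \<Rightarrow> bool" where
  "is_quiver Q \<longleftrightarrow>
     finite (verts Q) \<and>
     (\<forall>i j. arrows Q i j > 0 \<longrightarrow> i \<in> verts Q \<and> j \<in> verts Q) \<and>
     (\<forall>i. arrows Q i i = 0) \<and>
     (\<forall>i j. arrows Q i j = 0 \<or> arrows Q j i = 0)"

definition Arr :: "'v quiver \<Rightarrow> 'v \<Rightarrow> 'v \<Rightarrow> bool" where
  "Arr Q i j \<longleftrightarrow> arrows Q i j > 0"

definition In_verts :: "'v quiver \<Rightarrow> 'v \<Rightarrow> 'v set" where
  "In_verts Q j = {i. Arr Q i j}"

definition Out_verts :: "'v quiver \<Rightarrow> 'v \<Rightarrow> 'v set" where
  "Out_verts Q j = {i. Arr Q j i}"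

definition adjacent :: "'v quiver \<Rightarrow> 'v \<Rightarrow> 'v \<Rightarrow> bool" where
  "adjacent Q i j \<longleftrightarrow> Arr Q i j \<or> Arr Q j i"

definition add_paths :: "'v \<Rightarrow> ('v \<Rightarrow> 'v \<Rightarrow> nat) \<Rightarrow> 'v \<Rightarrow> 'v \<Rightarrow> nat" where
  "add_paths j q i k = q i k + q i j * q j k"

definition reverse_at :: "'v \<Rightarrow> ('v \<Rightarrow> 'v \<Rightarrow> nat) \<Rightarrow> 'v \<Rightarrow> 'v \<Rightarrow> nat" where
  "reverse_at j q i k = (if i = j \<or> k = j then q k i else q i k)"

text \<open>Exhaustively removing oriented 2-cycles on \<open>{i, k}\<close> removes \<open>min (q i k) (q k i)\<close> arrows in
  each direction, which is truncated subtraction.\<close>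

definition cancel_2cycles :: "('v \<Rightarrow> 'v \<Rightarrow> nat) \<Rightarrow> 'v \<Rightarrow> 'v \<Rightarrow> nat" where
  "cancel_2cycles q i k = q i k - q k i"

definition mutate :: "'v \<Rightarrow> 'v quiver \<Rightarrow> 'v quiver" where
  "mutate j Q = Q\<lparr>arrows := cancel_2cycles (reverse_at j (add_paths j (arrows Q)))\<rparr>"

lemma verts_mutate [simp]: "verts (mutate j Q) = verts Q"
  by (simp add: mutate_def)

lemma is_quiver_mutate:
  assumes "is_quiver Q"
  shows "is_quiver (mutate j Q)"
  unfolding is_quiver_def
proof (intro conjI allI impI)
  show "finite (verts (mutate j Q))"
    using assms by (simp add: is_quiver_def mutate_def)
next
  fix i k assume *: "0 < arrows (mutate j Q) i k"
  have "0 < arrows Q i k \<or> 0 < arrows Q k i \<or> (0 < arrows Q i j \<and> 0 < arrows Q j k)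
     \<or> (0 < arrows Q k j \<and> 0 < arrows Q j i)"
    using * by (auto simp: mutate_def cancel_2cycles_def reverse_at_def add_paths_def
        split: if_splits intro: ccontr)
  then show "i \<in> verts (mutate j Q)" "k \<in> verts (mutate j Q)"
    using assms by (auto simp: is_quiver_def mutate_def)
qed (auto simp: mutate_def cancel_2cycles_def)

text \<open>A cyclic ordering is the class, under cyclic shifts, of a linear ordering listed in
  clockwise direction.\<close>

definition cyc :: "'v list \<Rightarrow> 'v list set" where
  "cyc xs = {rotate n xs | n. True}"

definition cyclic_ordering :: "'v set \<Rightarrow> 'v list set \<Rightarrow> bool" where
  "cyclic_ordering V \<sigma> \<longleftrightarrow> (\<exists>xs. distinct xs \<and> set xs = V \<and> \<sigma> = cyc xs)"

type_synonym 'v coq = "'v quiver \<times> 'v list set"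

definition is_coq :: "'v coq \<Rightarrow> bool" where
  "is_coq C \<longleftrightarrow> is_quiver (fst C) \<and> cyclic_ordering (verts (fst C)) (snd C)"

text \<open>Since \<open>\<sigma>\<close> is closed under cyclic shifts, a consecutive pair may be taken to be the first two
  entries of a representative.\<close>

inductive wiggle :: "'v coq \<Rightarrow> 'v coq \<Rightarrow> bool" where
  "\<not> adjacent Q a b \<Longrightarrow> wiggle (Q, cyc (a # b # xs)) (Q, cyc (b # a # xs))"

definition wiggle_equivalent :: "'v coq \<Rightarrow> 'v coq \<Rightarrow> bool" where
  "wiggle_equivalent = equivclp wiggle"

definition clockwise :: "'v list set \<Rightarrow> 'v \<Rightarrow> 'v \<Rightarrow> 'v \<Rightarrow> bool" where
  "clockwise \<sigma> i j k \<longleftrightarrow> (\<exists>as bs cs ds. as @ i # bs @ j # cs @ k # ds \<in> \<sigma>)"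

definition proper_vertex :: "'v coq \<Rightarrow> 'v \<Rightarrow> bool" where
  "proper_vertex C j \<longleftrightarrow>
     (\<forall>i k. Arr (fst C) i j \<and> Arr (fst C) j k \<longrightarrow> clockwise (snd C) i j k)"

definition proper :: "'v coq \<Rightarrow> bool" where
  "proper C \<longleftrightarrow>
     (\<forall>j \<in> verts (fst C). \<exists>C'. wiggle_equivalent C C' \<and> proper_vertex C' j)"

text \<open>The vertex \<open>j\<close> is moved clockwise past exactly the vertices of \<open>xs\<close>. The result is only
  determined up to wiggles, so this is a relation.\<close>

inductive proper_mutation :: "'v \<Rightarrow> 'v coq \<Rightarrow> 'v coq \<Rightarrow> bool" for j :: 'v where
  "proper_vertex (Q, cyc (j # xs @ ys)) j \<Longrightarrow>
   Out_verts Q j \<subseteq> set xs \<Longrightarrow> In_verts Q j \<inter> set xs = {} \<Longrightarrow>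
   proper_mutation j (Q, cyc (j # xs @ ys)) (mutate j Q, cyc (xs @ j # ys))"

lemma cyclic_ordering_cyc_iff: "cyclic_ordering V (cyc xs) \<longleftrightarrow> distinct xs \<and> set xs = V"
proof
  assume "cyclic_ordering V (cyc xs)"
  then obtain ys where ys: "distinct ys" "set ys = V" "cyc xs = cyc ys"
    by (auto simp: cyclic_ordering_def)
  have "rotate 0 xs \<in> cyc xs"
    unfolding cyc_def by blast
  then obtain n where "xs = rotate n ys"
    using ys(3) by (auto simp: cyc_def)
  then show "distinct xs \<and> set xs = V"
    using ys by simp
qed (auto simp: cyclic_ordering_def)

lemma is_coq_wiggle: "wiggle C C' \<Longrightarrow> is_coq C \<Longrightarrow> is_coq C'"
  by (auto elim!: wiggle.cases simp: is_coq_def cyclic_ordering_cyc_iff)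

lemma is_coq_proper_mutation: "proper_mutation j C C' \<Longrightarrow> is_coq C \<Longrightarrow> is_coq C'"
  by (auto elim!: proper_mutation.cases
      simp: is_coq_def cyclic_ordering_cyc_iff is_quiver_mutate)

lemma cyc_rotate: "cyc (rotate n xs) = cyc xs"
proof -
  have "\<exists>k. rotate m xs = rotate (k + n) xs" for m
  proof (cases "xs = []")
    case False
    have "(m + n * (length xs - 1) + n) mod length xs = m mod length xs"
    proof -
      have "m + n * (length xs - 1) + n = m + n * length xs"
        using False by (cases "length xs") auto
      then show ?thesis by (simp only: mod_mult_self1)
    qed
    then show ?thesis by (metis rotate_conv_mod)
  qed simp
  then show ?thesis
    by (auto simp: cyc_def rotate_rotate)
qed

text \<open>The constraints in \<open>proper_mutation\<close> are satisfiable at every proper vertex.\<close>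

lemma proper_mutation_exists:
  assumes C: "is_coq (Q, \<sigma>)" and j: "j \<in> verts Q" and p: "proper_vertex (Q, \<sigma>) j"
  shows "\<exists>C'. proper_mutation j (Q, \<sigma>) C'"
proof -
  obtain us where us: "distinct us" "set us = verts Q" "\<sigma> = cyc us"
    using C by (auto simp: is_coq_def cyclic_ordering_def)
  obtain as bs where "us = as @ j # bs"
    using us j by (metis split_list)
  then have "rotate (length as) us = j # bs @ as"
    by (simp add: rotate_append)
  then obtain zs where zs: "\<sigma> = cyc (j # zs)"
    using us by (metis cyc_rotate)
  have d: "distinct (j # zs)" "set (j # zs) = verts Q"
    using C unfolding is_coq_def zs by (simp_all add: cyclic_ordering_cyc_iff)
  define xs where "xs = takeWhile (\<lambda>v. v \<notin> In_verts Q j) zs"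
  define ys where "ys = dropWhile (\<lambda>v. v \<notin> In_verts Q j) zs"
  have z: "zs = xs @ ys" by (simp add: xs_def ys_def)
  have "In_verts Q j \<inter> set xs = {}" by (auto simp: xs_def dest: set_takeWhileD)
  moreover have "Out_verts Q j \<subseteq> set xs"
  proof
    fix k assume k: "k \<in> Out_verts Q j"
    show "k \<in> set xs"
    proof (rule ccontr)
      assume "k \<notin> set xs"
      moreover have "k \<in> set zs"
      proof -
        have "Arr Q j k" using k by (simp add: Out_verts_def)
        then have "k \<in> verts Q" "k \<noteq> j"
          using C by (auto simp: is_coq_def is_quiver_def Arr_def)
        then show ?thesis using d by auto
      qed
      ultimately have ky: "k \<in> set ys" using z by auto
      then obtain i ys' where ys: "ys = i # ys'" by (cases ys) auto
      have i: "i \<in> In_verts Q j"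
        using ys hd_dropWhile[of "\<lambda>v. v \<notin> In_verts Q j" zs] by (auto simp: ys_def)
      have "clockwise \<sigma> i j k"
        using p i k by (auto simp: proper_vertex_def In_verts_def Out_verts_def)
      then obtain as bs cs ds where m: "as @ i # bs @ j # cs @ k # ds \<in> \<sigma>"
        by (auto simp: clockwise_def)
      then obtain n where n: "as @ i # bs @ j # cs @ k # ds = rotate n (j # zs)"
        by (auto simp: zs cyc_def)
      have "rotate (length (as @ i # bs)) ((as @ i # bs) @ (j # cs @ k # ds))
          = (j # cs @ k # ds) @ (as @ i # bs)" by (rule rotate_append)
      then have "j # cs @ k # ds @ as @ i # bs = rotate (length (as @ i # bs) + n) (j # zs)"
        using n by (simp flip: rotate_rotate)
      then obtain l where l: "l < length (j # zs)" "j # cs @ k # ds @ as @ i # bs = rotate l (j # zs)"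
        by (metis rotate_conv_mod mod_less_divisor length_greater_0_conv list.distinct(1))
      have "(rotate l (j # zs)) ! 0 = (j # zs) ! l"
        using l(1) by (subst nth_rotate) auto
      then have "l = 0"
        using l d(1) by (metis nth_Cons_0 nth_eq_iff_index_eq length_greater_0_conv list.distinct(1))
      then have e: "cs @ k # ds @ as @ i # bs = xs @ i # ys'"
        using l z ys by simp
      have "distinct (xs @ i # ys')" using d z ys by simp
      then have "xs = cs @ k # ds @ as"
        using e append_Cons_eq_iff[of i xs ys' "cs @ k # ds @ as" bs] by auto
      then show False using \<open>k \<notin> set xs\<close> by auto
    qed
  qed
  ultimately show ?thesis
    using p unfolding zs z by (blast intro: proper_mutation.intros)
qed

definition proper_mutation_class :: "'v coq \<Rightarrow> 'v coq set" where
  "proper_mutation_class C =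
     {C'. (\<lambda>A B. wiggle A B \<or> (\<exists>j. proper_mutation j A B))\<^sup>*\<^sup>* C C'}"

definition totally_proper :: "'v coq \<Rightarrow> bool" where
  "totally_proper C \<longleftrightarrow> (\<forall>C' \<in> proper_mutation_class C. proper C')"

end

theory Submission
  imports Defs
begin

text \<open>Cutting the circle open turns a cyclic ordering into a list; assign to a step \<open>a \<rightarrow> b\<close> along an
  edge of the quiver the number (0 or 1) of times it crosses the cut. Rotating the list changes
  this cochain by a coboundary and wiggling does not change it, so the difference of the cochains
  of two orderings has a well-defined cohomology class. Conversely, orderings whose difference is a
  coboundary are wiggle equivalent, by the argument with which Pretzel connects acyclic
  orientations of equal circulation by turning sinks into sources.

  For totally proper orderings the difference has zero circulation around every closed walk, by
  induction on its length. Walks with repetitions or chords split. On a chordless cycle with a path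
  \<open>i \<rightarrow> j \<rightarrow> k\<close>, make \<open>j\<close> proper and cut just before it: properness at \<open>j\<close> then fixes the
  contribution of \<open>i\<close>, \<open>j\<close>, \<open>k\<close>, and mutation at \<open>j\<close> creates an arrow \<open>i \<rightarrow> k\<close> that shortcuts the cycle.\<close>

section \<open>Circulations along closed walks\<close>

fun walk_sum :: "('v \<Rightarrow> 'v \<Rightarrow> int) \<Rightarrow> 'v list \<Rightarrow> int" where
  "walk_sum f (a # b # xs) = f a b + walk_sum f (b # xs)"
| "walk_sum f [] = 0"
| "walk_sum f [a] = 0"

definition circ :: "('v \<Rightarrow> 'v \<Rightarrow> int) \<Rightarrow> 'v list \<Rightarrow> int" where
  "circ f c = walk_sum f (c @ [hd c])"

text \<open>The starting vertex is listed only once, so the length of the list is the number of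
  steps. A singleton is a closed walk only at a loop.\<close>

definition closed_walk :: "('v \<Rightarrow> 'v \<Rightarrow> bool) \<Rightarrow> 'v list \<Rightarrow> bool" where
  "closed_walk E c \<longleftrightarrow> c \<noteq> [] \<and> successively E (c @ [hd c])"

lemma walk_sum_append: "walk_sum f (p @ x # q) = walk_sum f (p @ [x]) + walk_sum f (x # q)"
  by (induction p rule: induct_list012) auto

lemma walk_sum_rev:
  assumes "\<And>a b. f a b = - f b a"
  shows "walk_sum f (rev p) = - walk_sum f p"
proof (induction p rule: induct_list012)
  case (3 a b p)
  have "walk_sum f (rev (a # b # p)) = walk_sum f (rev (b # p)) + f b a"
    using walk_sum_append[of f "rev p" b "[a]"] by simp
  then show ?case using 3(2) assms[of a b] by simp
qed auto

lemma walk_sum_cong: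
  assumes "\<And>a b. a \<in> set p \<Longrightarrow> b \<in> set p \<Longrightarrow> f a b = g a b"
  shows "walk_sum f p = walk_sum g p"
  using assms by (induction p rule: induct_list012) auto

lemma walk_sum_potential:
  assumes "successively E p" "p \<noteq> []" "\<And>a b. E a b \<Longrightarrow> f a b = f' a b + (g b - g a)"
  shows "walk_sum f p = walk_sum f' p + (g (last p) - g (hd p))"
  using assms by (induction p rule: induct_list012) auto

lemma circ_potential:
  assumes "closed_walk E c" "\<And>a b. E a b \<Longrightarrow> f a b = f' a b + (g b - g a)"
  shows "circ f c = circ f' c"
  using walk_sum_potential[of E "c @ [hd c]" f f' g] assms
  by (simp add: circ_def closed_walk_def)

lemma circ_append_commute: "circ f (p @ q) = circ f (q @ p)"
proof (cases "p = [] \<or> q = []")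
  case False
  then obtain x p' y q' where "p = x # p'" "q = y # q'" by (metis neq_Nil_conv)
  then show ?thesis
    using walk_sum_append[of f p y "q' @ [x]"] walk_sum_append[of f q x "p' @ [y]"]
    by (simp add: circ_def)
qed auto

lemma closed_walk_append_commute: "closed_walk E (p @ q) \<Longrightarrow> closed_walk E (q @ p)"
proof (cases "p = [] \<or> q = []")
  case False
  then obtain x p' y q' where "p = x # p'" "q = y # q'" by (metis neq_Nil_conv)
  moreover assume "closed_walk E (p @ q)"
  ultimately show ?thesis
    by (auto simp: closed_walk_def successively_append_iff successively_Cons hd_append
        split: if_splits)
qed auto

text \<open>A chord between \<open>u\<close> and \<open>v\<close> is traversed once in each
  direction by the two pieces, and antisymmetry cancels these contributions. Nonemptiness of
  \<open>B\<close> and \<open>D\<close> makes both pieces shorter than the whole walk.\<close>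

lemma circ_split_zero:
  assumes c: "closed_walk E (u # B @ v # D)" "E u v \<or> u = v" "B \<noteq> []" "D \<noteq> []"
    and E: "symp E" and f: "\<And>a b. f a b = - f b a"
    and small: "\<And>c'. closed_walk E c' \<Longrightarrow> length c' < length (u # B @ v # D) \<Longrightarrow> circ f c' = 0"
  shows "circ f (u # B @ v # D) = 0"
proof -
  have s: "circ f (u # B @ v # D) = walk_sum f (u # B @ [v]) + walk_sum f (v # D @ [u])"
    using walk_sum_append[of f "u # B" v "D @ [u]"] by (simp add: circ_def)
  have w: "successively E (u # B @ [v])" "successively E (v # D @ [u])"
    using c(1) by (auto simp: closed_walk_def successively_append_iff successively_Cons hd_append
        split: if_splits)
  show ?thesis
  proof (cases "u = v")
    case True
    have "circ f (u # B) = 0" "circ f (v # D) = 0"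
      using w True by (auto intro!: small simp: closed_walk_def)
    then show ?thesis using s True by (simp add: circ_def)
  next
    case False
    then have e: "E u v" "E v u" using c(2) E by (auto dest: sympD)
    have "closed_walk E (u # B @ [v])" "closed_walk E (v # D @ [u])"
      using w e successively_append_iff[of E "u # B @ [v]" "[u]"]
        successively_append_iff[of E "v # D @ [u]" "[v]"]
      by (simp_all add: closed_walk_def)
    then have "circ f (u # B @ [v]) = 0" "circ f (v # D @ [u]) = 0"
      using c(3,4) by (auto intro!: small)
    moreover have "circ f (u # B @ [v]) = walk_sum f (u # B @ [v]) + f v u"
      using walk_sum_append[of f "u # B" v "[u]"] by (simp add: circ_def)
    moreover have "circ f (v # D @ [u]) = walk_sum f (v # D @ [u]) + f u v"
      using walk_sum_append[of f "v # D" u "[v]"] by (simp add: circ_def)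
    ultimately show ?thesis using s f[of u v] by simp
  qed
qed

lemma rtranclp_imp_walk:
  "E\<^sup>*\<^sup>* u v \<Longrightarrow> \<exists>p. p \<noteq> [] \<and> hd p = u \<and> last p = v \<and> successively E p"
proof (induction rule: rtranclp_induct)
  case base
  show ?case by (rule exI[of _ "[u]"]) simp
next
  case (step y z)
  then obtain p where "p \<noteq> []" "hd p = u" "last p = y" "successively E p" by blast
  with step(2) show ?case
    by (intro exI[of _ "p @ [z]"]) (simp add: successively_append_iff)
qed

text \<open>The potential integrates \<open>f\<close> along a chosen walk from a root of each
  connected component; vanishing circulation makes the choice of walk irrelevant.\<close>

lemma zero_circ_imp_potential:
  assumes E: "symp E" and f: "\<And>a b. f a b = - f b a"
    and zero: "\<And>c. closed_walk E c \<Longrightarrow> circ f c = 0"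
  shows "\<exists>g. \<forall>a b. E a b \<longrightarrow> f a b = g b - g a"
proof -
  \<comment> \<open>Adjacent vertices have equal reachability predicates, so the choice operator
    gives them the same root.\<close>
  define root where "root v = (SOME u. E\<^sup>*\<^sup>* v u)" for v
  have sym: "symp E\<^sup>*\<^sup>*" using E by (rule symp_rtranclp)
  have root: "E\<^sup>*\<^sup>* (root v) v" for v
    unfolding root_def by (rule sympD[OF sym]) (rule someI[of _ v], simp)
  have root_eq: "root a = root b" if "E a b" for a b
  proof -
    have "E\<^sup>*\<^sup>* a = E\<^sup>*\<^sup>* b"
      using that E by (intro ext) (meson converse_rtranclp_into_rtranclp sympD)
    then show ?thesis by (simp add: root_def)
  qed
  obtain P where P: "\<And>v. P v \<noteq> []" "\<And>v. hd (P v) = root v" "\<And>v. last (P v) = v"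
      "\<And>v. successively E (P v)"
    using rtranclp_imp_walk[OF root] by metis
  have "f a b = walk_sum f (P b) - walk_sum f (P a)" if ab: "E a b" for a b
  proof -
    \<comment> \<open>Out along \<open>P a\<close>, across the edge to \<open>b\<close>, back along
      \<open>P b\<close>. Taking the tail of \<open>P b\<close> drops the final root, which closing
      the walk supplies again.\<close>
    define c where "c = P a @ rev (tl (P b))"
    have c: "c @ [hd c] = P a @ rev (P b)"
      using P(1)[of a] P(1,2)[of b] P(2)[of a] root_eq[OF ab]
      by (cases "P b") (auto simp: c_def)
    have "(\<lambda>x y. E y x) = E" using E by (intro ext) (auto dest: sympD)
    then have "successively E (rev (P b))" using P(4)[of b] by (simp only: successively_rev)
    then have "closed_walk E c"
      using P ab unfolding closed_walk_def c
      by (auto simp: c_def successively_append_iff hd_rev)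
    then have "walk_sum f (P a @ rev (P b)) = 0" using zero c by (metis circ_def)
    moreover obtain p where p: "P a = p @ [a]" using P(1,3) by (metis append_butlast_last_id)
    moreover obtain q where q: "rev (P b) = b # q"
      using P(1,3) by (metis hd_rev rev_is_Nil_conv list.collapse)
    moreover have "walk_sum f ((p @ [a]) @ b # q) = walk_sum f (p @ [a]) + f a b + walk_sum f (b # q)"
      using walk_sum_append[of f p a "b # q"] by simp
    ultimately show ?thesis using walk_sum_rev[of f "P b", OF f] by simp
  qed
  then show ?thesis by (intro exI[of _ "\<lambda>v. walk_sum f (P v)"]) blast
qed

section \<open>The cohomology class of a cyclic ordering\<close>

fun before :: "'v list \<Rightarrow> 'v \<Rightarrow> 'v \<Rightarrow> bool" where
  "before [] a b \<longleftrightarrow> False"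
| "before (x # xs) a b \<longleftrightarrow> x = a \<and> b \<in> set xs \<or> before xs a b"

text \<open>The cut lies between the last entry and the first: travelling clockwise from
  \<open>a\<close> to \<open>b\<close> crosses it exactly when \<open>b\<close> stands before
  \<open>a\<close>.\<close>

definition wind :: "'v list \<Rightarrow> 'v \<Rightarrow> 'v \<Rightarrow> int" where
  "wind xs a b = of_bool (before xs b a)"

definition diff :: "'v list \<Rightarrow> 'v list \<Rightarrow> 'v \<Rightarrow> 'v \<Rightarrow> int" where
  "diff xs ys a b = wind xs a b - wind ys a b"

definition cohomologous :: "'v quiver \<Rightarrow> 'v list \<Rightarrow> 'v list \<Rightarrow> bool" where
  "cohomologous Q xs ys \<longleftrightarrow> (\<exists>g. \<forall>a b. adjacent Q a b \<longrightarrow> diff xs ys a b = g b - g a)"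

lemma before_append [simp]:
  "before (xs @ ys) a b \<longleftrightarrow> before xs a b \<or> before ys a b \<or> a \<in> set xs \<and> b \<in> set ys"
  by (induction xs) auto

lemma before_in_set: "before xs a b \<Longrightarrow> a \<in> set xs \<and> b \<in> set xs"
  by (induction xs) auto

lemma before_asym: "distinct xs \<Longrightarrow> before xs a b \<Longrightarrow> \<not> before xs b a"
  by (induction xs) (auto dest: before_in_set)

lemma before_total: "a \<in> set xs \<Longrightarrow> b \<in> set xs \<Longrightarrow> a \<noteq> b \<Longrightarrow> before xs a b \<or> before xs b a"
  by (induction xs) auto

text \<open>Going clockwise from \<open>a\<close> to \<open>b\<close> and on to \<open>a\<close> is
  one full turn, which crosses the cut once. This sum is independent of the ordering, so differences
  of two orderings are antisymmetric although \<open>wind\<close> is not.\<close>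

lemma wind_add_swap:
  assumes "distinct xs"
  shows "wind xs a b + wind xs b a = of_bool (a \<in> set xs \<and> b \<in> set xs \<and> a \<noteq> b)"
  unfolding wind_def
  using before_asym[OF assms, of a b] before_in_set[of xs a b] before_in_set[of xs b a]
    before_total[of a xs b] by auto

lemma diff_antisym:
  assumes "distinct xs" "distinct ys" "set xs = set ys"
  shows "diff xs ys a b = - diff xs ys b a"
  using wind_add_swap[OF assms(1), of a b] wind_add_swap[OF assms(2), of a b]
  unfolding assms(3) diff_def by linarith

lemma adjacent_sym: "adjacent Q a b \<longleftrightarrow> adjacent Q b a"
  by (auto simp: adjacent_def)

lemma symp_adjacent: "symp (adjacent Q)"
  by (auto simp: symp_def adjacent_def)

lemma adjacentD:
  assumes "is_quiver Q" "adjacent Q a b"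
  shows "a \<in> verts Q" "b \<in> verts Q" "a \<noteq> b"
  using assms by (auto simp: is_quiver_def adjacent_def Arr_def)

lemma cohomologous_refl: "cohomologous Q xs xs"
  unfolding cohomologous_def by (intro exI[of _ "\<lambda>_. 0"]) (simp add: diff_def)

lemma cohomologous_trans:
  assumes "cohomologous Q xs ys" "cohomologous Q ys zs"
  shows "cohomologous Q xs zs"
proof -
  obtain g h where gh: "\<And>a b. adjacent Q a b \<Longrightarrow> diff xs ys a b = g b - g a"
    "\<And>a b. adjacent Q a b \<Longrightarrow> diff ys zs a b = h b - h a"
    using assms by (auto simp: cohomologous_def)
  have "diff xs zs a b = (g b + h b) - (g a + h a)" if "adjacent Q a b" for a b
    using gh[OF that] by (simp add: diff_def)
  then show ?thesis
    unfolding cohomologous_def by (intro exI[of _ "\<lambda>v. g v + h v"]) blast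
qed

lemma cohomologous_rotate1:
  assumes "is_quiver Q" "distinct xs" "set xs = verts Q"
  shows "cohomologous Q (rotate1 xs) xs"
proof (cases xs)
  case (Cons v zs)
  \<comment> \<open>Moving \<open>v\<close> across the cut adds 1 on steps leaving \<open>v\<close>
    and subtracts 1 on steps entering it.\<close>
  have "diff (rotate1 xs) xs a b = of_bool (b \<noteq> v) - of_bool (a \<noteq> v)" if "adjacent Q a b" for a b
    using adjacentD[OF assms(1) that] assms(2,3) Cons
    by (auto simp: diff_def wind_def dest: before_in_set)
  then show ?thesis
    unfolding cohomologous_def
    by (intro exI[of _ "\<lambda>x. of_bool (x \<noteq> v)"]) blast
qed (simp add: cohomologous_refl)

lemma cohomologous_rotate:
  assumes "is_quiver Q" "distinct xs" "set xs = verts Q"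
  shows "cohomologous Q (rotate n xs) xs"
proof (induction n)
  case (Suc n)
  then show ?case
    using cohomologous_rotate1[OF assms(1), of "rotate n xs"] assms
    by (auto intro: cohomologous_trans)
qed (simp add: cohomologous_refl)

lemma mem_cyc_self: "xs \<in> cyc xs"
  unfolding cyc_def by (auto intro: exI[of _ 0])

lemma is_coq_cyc: "is_coq (Q, cyc xs) \<longleftrightarrow> is_quiver Q \<and> distinct xs \<and> set xs = verts Q"
  by (simp add: is_coq_def cyclic_ordering_cyc_iff)

lemma cohomologous_cyc_eq:
  assumes "cyc xs = cyc ys" "is_coq (Q, cyc xs)"
  shows "cohomologous Q xs ys"
proof -
  obtain n where "xs = rotate n ys" using assms(1) mem_cyc_self[of xs] by (auto simp: cyc_def)
  then show ?thesis using assms cohomologous_rotate[of Q ys n] by (simp add: is_coq_cyc)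
qed

lemma wiggle_sym: "wiggle C C' \<Longrightarrow> wiggle C' C"
  by (auto elim!: wiggle.cases intro!: wiggle.intros simp: adjacent_sym)

lemma wiggle_equivalent_cohomologous:
  assumes "wiggle_equivalent (Q, cyc xs) C" "is_coq (Q, cyc xs)"
  shows "\<exists>ys. C = (Q, cyc ys) \<and> is_coq C \<and> cohomologous Q xs ys"
  using assms(1) unfolding wiggle_equivalent_def
proof (induction rule: equivclp_induct)
  case base
  then show ?case using assms(2) cohomologous_refl by blast
next
  case (step C C')
  then obtain ys where ys: "C = (Q, cyc ys)" "is_coq C" "cohomologous Q xs ys" by blast
  have w: "wiggle C C'" using step(2) wiggle_sym by blast
  then obtain a b zs where z: "cyc ys = cyc (a # b # zs)" "C' = (Q, cyc (b # a # zs))"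
      "\<not> adjacent Q a b"
    using ys(1) by (auto elim: wiggle.cases)
  have "cohomologous Q xs (a # b # zs)"
    using ys z cohomologous_cyc_eq cohomologous_trans by metis
  \<comment> \<open>The swap changes \<open>wind\<close> on the pair \<open>a\<close>,
    \<open>b\<close> alone, which is not an edge.\<close>
  moreover have "cohomologous Q (a # b # zs) (b # a # zs)"
    unfolding cohomologous_def using z(3)
    by (intro exI[of _ "\<lambda>_. 0"]) (auto simp: diff_def wind_def adjacent_def)
  ultimately show ?case
    using z(2) is_coq_wiggle[OF w ys(2)] cohomologous_trans by blast
qed

section \<open>Cohomologous cyclic orderings are wiggle equivalent\<close>

lemma wiggle_equivalent_refl: "wiggle_equivalent C C"
  by (simp add: wiggle_equivalent_def)

lemma wiggle_equivalent_trans [trans]: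
  "wiggle_equivalent C C' \<Longrightarrow> wiggle_equivalent C' C'' \<Longrightarrow> wiggle_equivalent C C''"
  unfolding wiggle_equivalent_def by (rule equivclp_trans)

lemma cyc_append_commute: "cyc (xs @ ys) = cyc (ys @ xs)"
  by (metis cyc_rotate rotate_append)

lemma wiggle_equivalent_move:
  "\<forall>u \<in> set us. \<not> adjacent Q u v \<Longrightarrow>
   wiggle_equivalent (Q, cyc (p @ us @ v # q)) (Q, cyc (p @ v # us @ q))"
proof (induction us arbitrary: p)
  case (Cons u us)
  have "wiggle_equivalent (Q, cyc ((p @ [u]) @ us @ v # q)) (Q, cyc ((p @ [u]) @ v # us @ q))"
    using Cons.prems by (intro Cons.IH) auto
  \<comment> \<open>A wiggle acts on the first two entries, so \<open>p\<close> is rotated to the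
    end.\<close>
  moreover have "wiggle (Q, cyc (u # v # us @ q @ p)) (Q, cyc (v # u # us @ q @ p))"
    using Cons(2) by (auto intro: wiggle.intros)
  then have "wiggle_equivalent (Q, cyc (p @ u # v # us @ q)) (Q, cyc (p @ v # u # us @ q))"
    using cyc_append_commute[of p "u # v # us @ q"] cyc_append_commute[of p "v # u # us @ q"]
    by (simp add: wiggle_equivalent_def r_into_equivclp)
  ultimately show ?case by (auto intro: wiggle_equivalent_trans)
qed (simp add: wiggle_equivalent_refl)

text \<open>Vertices standing before \<open>y\<close> in \<open>xs\<close> are not adjacent to
  \<open>y\<close>, because \<open>y\<close> comes first in the other list. Hence \<open>y\<close>
  can be wiggled to the front, where it joins the common prefix \<open>p\<close>.\<close>

lemma wiggle_equivalent_same_orientation: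
  assumes "distinct xs" "distinct ys" "set xs = set ys"
    and "\<And>a b. adjacent Q a b \<Longrightarrow> a \<in> set xs \<Longrightarrow> b \<in> set xs \<Longrightarrow> before xs a b \<longleftrightarrow> before ys a b"
  shows "wiggle_equivalent (Q, cyc (p @ xs)) (Q, cyc (p @ ys))"
  using assms
proof (induction ys arbitrary: xs p)
  case (Cons y ys)
  then obtain us vs where xs: "xs = us @ y # vs" by (metis list.set_intros(1) split_list)
  have "\<not> adjacent Q u y" if "u \<in> set us" for u
    using that Cons.prems(4)[of u y] Cons.prems(1-3) xs by (auto dest: before_in_set)
  then have "wiggle_equivalent (Q, cyc (p @ xs)) (Q, cyc ((p @ [y]) @ us @ vs))"
    using wiggle_equivalent_move[of us Q y p vs] xs by simp
  also have "wiggle_equivalent (Q, cyc ((p @ [y]) @ us @ vs)) (Q, cyc ((p @ [y]) @ ys))"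
  proof (rule Cons.IH)
    show s: "set (us @ vs) = set ys"
      using Cons.prems(1-3) xs by auto
    fix a b assume ab: "adjacent Q a b" "a \<in> set (us @ vs)" "b \<in> set (us @ vs)"
    have "a \<noteq> y" "b \<noteq> y" using ab xs Cons.prems(1) by auto
    then show "before (us @ vs) a b \<longleftrightarrow> before ys a b"
      using Cons.prems(4)[OF ab(1)] ab xs by auto
  qed (use Cons.prems xs in auto)
  finally show ?case by simp
qed (simp add: wiggle_equivalent_refl)

text \<open>A vertex of maximal potential precedes all its neighbours of smaller potential. The first of
  these vertices can therefore be wiggled to the front and then shifted to the end, which lowers
  its potential by one.\<close>

lemma wiggle_equivalent_if_potential:
  fixes g :: "'v \<Rightarrow> nat"
  assumes "is_quiver Q" "distinct xs" "set xs = verts Q" "distinct ys" "set ys = verts Q"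
    and "\<forall>a b. adjacent Q a b \<longrightarrow> diff xs ys a b = int (g b) - int (g a)"
  shows "wiggle_equivalent (Q, cyc xs) (Q, cyc ys)"
  using assms
proof (induction "sum g (verts Q)" arbitrary: xs g rule: less_induct)
  case less
  note prems = less.prems
  have fin: "finite (verts Q)" using prems(3) by (metis List.finite_set)
  show ?case
  proof (cases "\<forall>v \<in> verts Q. g v = 0")
    case True
    have "before xs a b \<longleftrightarrow> before ys a b" if "adjacent Q a b" for a b
      using prems(6)[rule_format, of b a] that True adjacentD[OF prems(1) that]
      by (auto simp: adjacent_sym diff_def wind_def split: if_splits)
    then show ?thesis
      using wiggle_equivalent_same_orientation[of xs ys Q "[]"] prems by simp
  next
    case False
    define m where "m = Max (g ` verts Q)"
    have ne: "verts Q \<noteq> {}" using False by auto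
    have max: "g v \<le> m" if "v \<in> verts Q" for v using that fin by (simp add: m_def)
    have "m > 0" using False max by fastforce
    have "m \<in> g ` verts Q"
      using fin ne unfolding m_def by (intro Max_in) auto
    then have "\<exists>v \<in> set xs. g v = m"
      using prems(3) by auto
    then obtain p v q where xs: "xs = p @ v # q" "g v = m" "\<forall>u \<in> set p. g u \<noteq> m"
      using split_list_first_prop[of xs "\<lambda>v. g v = m"] by blast
    have nadj: "\<not> adjacent Q u v" if u: "u \<in> set p" for u
    proof
      assume a: "adjacent Q u v"
      have "g u < m" using u xs max prems(3) by (metis UnCI le_neq_implies_less set_append)
      \<comment> \<open>Impossible: \<open>u\<close> precedes \<open>v\<close> in \<open>xs\<close>,
        so the left-hand side already has the maximal value 1.\<close>
      then have "wind xs v u < wind ys v u"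
        using prems(6)[rule_format, of v u] a xs by (simp add: adjacent_sym diff_def)
      then show False using u xs by (auto simp: wind_def of_bool_def split: if_splits)
    qed
    define h where "h = g(v := m - 1)"
    have "wiggle_equivalent (Q, cyc xs) (Q, cyc (v # p @ q))"
      using wiggle_equivalent_move[of p Q v "[]" q] nadj xs by simp
    also have "cyc (v # p @ q) = cyc (p @ q @ [v])"
      using cyc_append_commute[of "[v]" "p @ q"] by simp
    also have "wiggle_equivalent (Q, cyc (p @ q @ [v])) (Q, cyc ys)"
    proof (rule less.hyps[of h])
      have "sum h (verts Q) < sum g (verts Q)"
        using fin \<open>m > 0\<close> xs prems(3) by (intro sum_strict_mono_ex1) (auto simp: h_def)
      then show "sum h (verts Q) < sum g (verts Q)" .
      show "\<forall>a b. adjacent Q a b \<longrightarrow> diff (p @ q @ [v]) ys a b = int (h b) - int (h a)"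
      proof (intro allI impI)
        fix a b assume ab: "adjacent Q a b"
        \<comment> \<open>Wiggling \<open>v\<close> to the front changes nothing on edges; shifting
          it to the end adds the coboundary that lowering the potential at \<open>v\<close>
          absorbs.\<close>
        have "diff (p @ q @ [v]) ys a b = diff xs ys a b + of_bool (a = v) - of_bool (b = v)"
          using adjacentD[OF prems(1) ab] ab nadj[of a] nadj[of b] prems(2,3) xs(1)
          by (auto simp: diff_def wind_def adjacent_sym dest: before_in_set)
        then show "diff (p @ q @ [v]) ys a b = int (h b) - int (h a)"
          using prems(6) ab xs(2) \<open>m > 0\<close> adjacentD[OF prems(1) ab] by (auto simp: h_def)
      qed
    qed (use prems xs(1) in auto)
    finally show ?thesis .
  qed
qed

lemma wiggle_equivalent_if_cohomologous:
  assumes "is_coq (Q, cyc xs)" "is_coq (Q, cyc ys)" "cohomologous Q xs ys"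
  shows "wiggle_equivalent (Q, cyc xs) (Q, cyc ys)"
proof -
  obtain g where g: "\<And>a b. adjacent Q a b \<Longrightarrow> diff xs ys a b = g b - g a"
    using assms(3) by (auto simp: cohomologous_def)
  have q: "is_quiver Q" and "finite (verts Q)"
    using assms(1) by (auto simp: is_coq_cyc is_quiver_def)
  \<comment> \<open>Subtracting a lower bound makes the integer potential natural-valued, as the
    descent on its sum requires.\<close>
  then have "bdd_below (g ` verts Q)" by simp
  then obtain m where m: "\<And>v. v \<in> verts Q \<Longrightarrow> m \<le> g v" by (auto simp: bdd_below_def)
  have "diff xs ys a b = int (nat (g b - m)) - int (nat (g a - m))" if "adjacent Q a b" for a b
    using g[OF that] m adjacentD[OF q that] by simp
  then show ?thesis
    using wiggle_equivalent_if_potential[of Q xs ys "\<lambda>v. nat (g v - m)"] assms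
    by (simp add: is_coq_cyc)
qed

section \<open>Circulations of totally proper orderings\<close>

lemma wiggle_equivalent_proper_mutation_class:
  assumes "wiggle_equivalent C C'"
  shows "C' \<in> proper_mutation_class C"
  using assms unfolding wiggle_equivalent_def
proof (induction rule: equivclp_induct)
  case (step C' C'')
  have "wiggle C' C''" using step(2) wiggle_sym by blast
  then show ?case
    using step(3) by (auto simp: proper_mutation_class_def intro: rtranclp.rtrancl_into_rtrancl)
qed (simp add: proper_mutation_class_def)

lemma totally_proper_trans:
  assumes "totally_proper C" "C' \<in> proper_mutation_class C"
  shows "totally_proper C'"
  using assms by (auto simp: totally_proper_def proper_mutation_class_def intro: rtranclp_trans)

text \<open>Wiggling until \<open>j\<close> is proper and cutting just before \<open>j\<close> stays
  in the cohomology class, so circulations can be computed in this form. Properness separates the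
  out-neighbours in \<open>us\<close> from the in-neighbours in \<open>vs\<close>, and mutation
  moves \<open>j\<close> past \<open>us\<close>.\<close>

lemma totally_proper_mutation:
  assumes coq: "is_coq (Q, cyc xs)" and tp: "totally_proper (Q, cyc xs)" and j: "j \<in> verts Q"
  shows "\<exists>us vs. is_coq (Q, cyc (j # us @ vs)) \<and> cohomologous Q xs (j # us @ vs) \<and>
    Out_verts Q j \<subseteq> set us \<and> In_verts Q j \<subseteq> set vs \<and>
    is_coq (mutate j Q, cyc (us @ j # vs)) \<and> totally_proper (mutate j Q, cyc (us @ j # vs))"
proof -
  have "proper (Q, cyc xs)"
    using tp by (auto simp: totally_proper_def proper_mutation_class_def)
  then obtain C where C: "wiggle_equivalent (Q, cyc xs) C" "proper_vertex C j"
    using j by (auto simp: proper_def)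
  obtain ys where ys: "C = (Q, cyc ys)" "is_coq C" "cohomologous Q xs ys"
    using wiggle_equivalent_cohomologous[OF C(1) coq] by blast
  obtain C' where C': "proper_mutation j C C'"
    using proper_mutation_exists[of Q "cyc ys" j] j C(2) ys by auto
  then obtain us vs where uv: "cyc ys = cyc (j # us @ vs)" "C' = (mutate j Q, cyc (us @ j # vs))"
      "Out_verts Q j \<subseteq> set us" "In_verts Q j \<inter> set us = {}"
    using ys(1) by (auto elim: proper_mutation.cases)
  have coq': "is_coq (Q, cyc (j # us @ vs))" using ys uv by simp
  have "C' \<in> proper_mutation_class C"
    using C' by (auto simp: proper_mutation_class_def)
  then have "totally_proper C'"
    using totally_proper_trans wiggle_equivalent_proper_mutation_class C(1) tp by blast
  moreover have "is_coq C'" by (rule is_coq_proper_mutation[OF C' ys(2)])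
  moreover have "cohomologous Q xs (j # us @ vs)"
    using ys uv(1) cohomologous_cyc_eq[of ys "j # us @ vs" Q] cohomologous_trans by auto
  moreover have "In_verts Q j \<subseteq> set vs"
  proof
    fix x assume x: "x \<in> In_verts Q j"
    then have "adjacent Q x j" by (simp add: In_verts_def adjacent_def)
    then have "x \<in> verts Q" "x \<noteq> j"
      using adjacentD[of Q x j] coq' by (auto simp: is_coq_cyc)
    then show "x \<in> set vs" using x uv(4) coq' by (auto simp: is_coq_cyc)
  qed
  ultimately show ?thesis
    using coq' uv(2,3) by (intro exI[of _ us] exI[of _ vs]) simp
qed

lemma circ_cohomologous:
  assumes "cohomologous Q xs xs'" "cohomologous Q ys ys'" "closed_walk (adjacent Q) c"
  shows "circ (diff xs ys) c = circ (diff xs' ys') c"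
proof -
  obtain g h where "\<And>a b. adjacent Q a b \<Longrightarrow> diff xs xs' a b = g b - g a"
    "\<And>a b. adjacent Q a b \<Longrightarrow> diff ys ys' a b = h b - h a"
    using assms by (auto simp: cohomologous_def)
  then have "adjacent Q a b \<Longrightarrow> diff xs ys a b = diff xs' ys' a b + ((g b - h b) - (g a - h a))"
    for a b by (fastforce simp: diff_def)
  then show ?thesis by (rule circ_potential[OF assms(3), where g="\<lambda>v. g v - h v"])
qed

section \<open>Effect of a mutation on arrows and cochains\<close>

lemma arrows_mutate_unaffected:
  assumes "is_quiver Q" "a \<noteq> j" "b \<noteq> j"
    and "\<not> (Arr Q a j \<and> Arr Q j b)" "\<not> (Arr Q b j \<and> Arr Q j a)"
  shows "arrows (mutate j Q) a b = arrows Q a b"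
proof -
  have "arrows Q a b = 0 \<or> arrows Q b a = 0" using assms(1) by (simp add: is_quiver_def)
  then show ?thesis
    using assms by (auto simp: mutate_def cancel_2cycles_def reverse_at_def add_paths_def Arr_def)
qed

lemma Arr_mutate_reverse:
  assumes "is_quiver Q"
  shows "Arr (mutate j Q) j a \<longleftrightarrow> Arr Q a j" "Arr (mutate j Q) a j \<longleftrightarrow> Arr Q j a"
proof -
  have "arrows Q a j = 0 \<or> arrows Q j a = 0" "arrows Q j j = 0"
    using assms by (auto simp: is_quiver_def)
  then show "Arr (mutate j Q) j a \<longleftrightarrow> Arr Q a j" "Arr (mutate j Q) a j \<longleftrightarrow> Arr Q j a"
    by (auto simp: mutate_def cancel_2cycles_def reverse_at_def add_paths_def Arr_def)
qed

text \<open>Neither an old arrow between \<open>a\<close> and \<open>b\<close> nor a path from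
  \<open>b\<close> through \<open>j\<close> to \<open>a\<close> exists, so nothing cancels the new
  arrows.\<close>

lemma Arr_mutate_path:
  assumes "is_quiver Q" "Arr Q a j" "Arr Q j b" "\<not> adjacent Q a b"
  shows "Arr (mutate j Q) a b"
proof -
  have no_2cycle: "arrows Q x y = 0 \<or> arrows Q y x = 0" for x y
    using assms(1) by (simp add: is_quiver_def)
  have "arrows Q j a = 0" "arrows Q b j = 0" "a \<noteq> j" "b \<noteq> j"
    using assms(2,3) no_2cycle[of a j] no_2cycle[of b j] no_2cycle[of j j] by (auto simp: Arr_def)
  then show ?thesis
    using assms
    by (auto simp: mutate_def cancel_2cycles_def reverse_at_def add_paths_def Arr_def adjacent_def)
qed

lemma diff_mutation_unaffected:
  assumes "a \<noteq> j" "b \<noteq> j"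
  shows "diff (us @ j # vs) (us' @ j # vs') a b = diff (j # us @ vs) (j # us' @ vs') a b"
  using assms by (auto simp: diff_def wind_def)

text \<open>With both cuts just before \<open>j\<close>, a step out of \<open>j\<close> crosses
  neither and a step into \<open>j\<close> from another vertex crosses both.\<close>

lemma diff_Cons_eq_zero:
  assumes "distinct (j # us)" "distinct (j # us')" "set us = set us'"
  shows "diff (j # us) (j # us') a j = 0" "diff (j # us) (j # us') j a = 0"
  using assms by (auto simp: diff_def wind_def dest: before_in_set)

section \<open>The induction step for closed walks of length \<open>n\<close>\<close>

context
  fixes n :: nat
  assumes shorter: "\<And>(Q :: 'v quiver) xs ys c. is_coq (Q, cyc xs) \<Longrightarrow> is_coq (Q, cyc ys) \<Longrightarrow>
    totally_proper (Q, cyc xs) \<Longrightarrow> totally_proper (Q, cyc ys) \<Longrightarrow>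
    closed_walk (adjacent Q) c \<Longrightarrow> length c < n \<Longrightarrow> circ (diff xs ys) c = 0"
begin

lemma circ_eq_zero_if_chord:
  fixes Q :: "'v quiver"
  assumes "is_coq (Q, cyc xs)" "is_coq (Q, cyc ys)"
    and "totally_proper (Q, cyc xs)" "totally_proper (Q, cyc ys)"
    and "closed_walk (adjacent Q) (i # j # k # D)" "length (i # j # k # D) = n"
    and "D \<noteq> [] \<and> adjacent Q i k \<or> (\<exists>d \<in> set D. d = j \<or> adjacent Q j d)"
  shows "circ (diff xs ys) (i # j # k # D) = 0"
proof -
  have anti: "diff xs ys a b = - diff xs ys b a" for a b
    using assms(1,2) by (intro diff_antisym) (auto simp: is_coq_cyc)
  note small = shorter[OF assms(1-4), folded assms(6)]
  from assms(7) show ?thesis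
  proof (elim disjE conjE bexE)
    assume chord: "D \<noteq> []" "adjacent Q i k"
    have "circ (diff xs ys) (i # [j] @ k # D) = 0"
      by (rule circ_split_zero[OF _ disjI1[OF chord(2)] _ chord(1) symp_adjacent anti])
        (use small assms(5) in auto)
    then show ?thesis by simp
  next
    have *: "circ (diff xs ys) (i # j # k # D) = 0" if d: "d \<in> set D" "adjacent Q j d \<or> j = d" for d
    proof -
      obtain D1 D2 where D: "D = D1 @ d # D2" using split_list[OF d(1)] by blast
      \<comment> \<open>The walk is rotated to start at \<open>j\<close>; then \<open>k\<close> and
        \<open>i\<close> keep both pieces nonempty.\<close>
      have "circ (diff xs ys) (j # (k # D1) @ d # (D2 @ [i])) = 0"
      proof (rule circ_split_zero[OF _ d(2) _ _ symp_adjacent anti])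
        show "closed_walk (adjacent Q) (j # (k # D1) @ d # (D2 @ [i]))"
          using assms(5) closed_walk_append_commute[of _ "[i]" "j # k # D"] D by simp
      qed (use small D in auto)
      then show ?thesis
        using circ_append_commute[of _ "[i]" "j # k # D"] D by simp
    qed
    { fix d assume "d \<in> set D" "d = j" then show ?thesis using * by blast }
    { fix d assume "d \<in> set D" "adjacent Q j d" then show ?thesis using * by blast }
  qed
qed

lemma circ_eq_zero_if_path:
  fixes Q :: "'v quiver"
  assumes coq: "is_coq (Q, cyc xs)" "is_coq (Q, cyc ys)"
    and tp: "totally_proper (Q, cyc xs)" "totally_proper (Q, cyc ys)"
    and c: "closed_walk (adjacent Q) (i # j # k # D)" "length (i # j # k # D) = n"
    and path: "Arr Q i j \<and> Arr Q j k \<or> Arr Q k j \<and> Arr Q j i"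
  shows "circ (diff xs ys) (i # j # k # D) = 0"
proof (cases "D \<noteq> [] \<and> adjacent Q i k \<or> (\<exists>d \<in> set D. d = j \<or> adjacent Q j d)")
  case True
  then show ?thesis using circ_eq_zero_if_chord assms by blast
next
  case False
  have q: "is_quiver Q" using coq by (simp add: is_coq_cyc)
  have adj: "adjacent Q i j" "adjacent Q j k" using c by (auto simp: closed_walk_def)
  note v = adjacentD[OF q adj(1)] adjacentD[OF q adj(2)]
  obtain us vs where uv: "is_coq (Q, cyc (j # us @ vs))" "cohomologous Q xs (j # us @ vs)"
    "Out_verts Q j \<subseteq> set us" "In_verts Q j \<subseteq> set vs"
    "is_coq (mutate j Q, cyc (us @ j # vs))" "totally_proper (mutate j Q, cyc (us @ j # vs))"
    using totally_proper_mutation[OF coq(1) tp(1) v(2)] by blast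
  obtain us' vs' where uv': "is_coq (Q, cyc (j # us' @ vs'))" "cohomologous Q ys (j # us' @ vs')"
    "Out_verts Q j \<subseteq> set us'" "In_verts Q j \<subseteq> set vs'"
    "is_coq (mutate j Q, cyc (us' @ j # vs'))" "totally_proper (mutate j Q, cyc (us' @ j # vs'))"
    using totally_proper_mutation[OF coq(2) tp(2) v(2)] by blast
  define f where "f = diff (j # us @ vs) (j # us' @ vs')"
  have dist: "distinct (j # us @ vs)" "distinct (j # us' @ vs')" "set (us @ vs) = set (us' @ vs')"
    using uv(1) uv'(1) by (auto simp: is_coq_cyc)
  have fj: "f i j = 0" "f j k = 0"
    using diff_Cons_eq_zero[OF dist] by (simp_all add: f_def)
  \<comment> \<open>One of \<open>i\<close>, \<open>k\<close> is an out-neighbour of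
    \<open>j\<close> and the other an in-neighbour, so both lists place them in the same
    order.\<close>
  have fik: "f i k = 0" "f k i = 0"
    using path uv(3,4) uv'(3,4) dist v
    by (auto simp: f_def diff_def wind_def In_verts_def Out_verts_def dest: before_in_set)
  have "circ (diff xs ys) (i # j # k # D) = circ f (i # j # k # D)"
    unfolding f_def using circ_cohomologous uv(2) uv'(2) c(1) by blast
  also have "\<dots> = walk_sum f (k # D @ [i])" using fj by (simp add: circ_def)
  also have "\<dots> = 0"
  proof (cases "D = []")
    case True
    then show ?thesis using fik by simp
  next
    case D: False
    \<comment> \<open>Without chords at \<open>j\<close>, the mutation cannot alter any edge of the
      walk that meets \<open>D\<close>.\<close>
    have far: "d \<noteq> j" "\<not> adjacent Q j d" if "d \<in> set D" for d using False that by auto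
    have keep: "adjacent (mutate j Q) a b"
      if "adjacent Q a b" "a \<noteq> j" "b \<noteq> j" "a \<in> set D \<or> b \<in> set D" for a b
      using that far arrows_mutate_unaffected[OF q, of a j b] arrows_mutate_unaffected[OF q, of b j a]
      by (auto simp: adjacent_def Arr_def)
    have "successively (adjacent (mutate j Q)) (D' @ [i])"
      if "successively (adjacent Q) (D' @ [i])" "set D' \<subseteq> set D" for D'
      using that
    proof (induction D' rule: induct_list012)
      case (2 x)
      then show ?case using keep far v by auto
    next
      case (3 x y zs)
      then show ?case using keep far by auto
    qed simp
    moreover have "successively (adjacent Q) (D @ [i])" "adjacent Q k (hd D)"
      using c(1) D by (auto simp: closed_walk_def successively_Cons)
    moreover have "adjacent (mutate j Q) i k"
      using path Arr_mutate_path[OF q] False D by (auto simp: adjacent_def)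
    ultimately have "closed_walk (adjacent (mutate j Q)) (i # k # D)"
      using D keep[of k "hd D"] far v by (auto simp: closed_walk_def successively_Cons)
    \<comment> \<open>The shorter walk lives in the mutated quiver, which is why
      \<open>shorter\<close> ranges over all quivers.\<close>
    then have "circ (diff (us @ j # vs) (us' @ j # vs')) (i # k # D) = 0"
      using shorter uv(5,6) uv'(5,6) c(2) by simp
    moreover have "walk_sum (diff (us @ j # vs) (us' @ j # vs')) (i # k # D @ [i])
        = walk_sum f (i # k # D @ [i])"
      unfolding f_def using v far
      by (intro walk_sum_cong diff_mutation_unaffected) auto
    ultimately show ?thesis using fik by (simp add: circ_def)
  qed
  finally show ?thesis .
qed

text \<open>If every vertex of a chordless cycle is a source or a sink of the cycle, a mutation at one of
  them leaves the circulation unchanged and creates a directed path through its neighbour.\<close>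

lemma circ_eq_zero:
  fixes Q :: "'v quiver"
  assumes coq: "is_coq (Q, cyc xs)" "is_coq (Q, cyc ys)"
    and tp: "totally_proper (Q, cyc xs)" "totally_proper (Q, cyc ys)"
    and c: "closed_walk (adjacent Q) (i # j # k # D)" "length (i # j # k # D) = n"
  shows "circ (diff xs ys) (i # j # k # D) = 0"
proof (rule ccontr)
  assume nz: "circ (diff xs ys) (i # j # k # D) \<noteq> 0"
  have q: "is_quiver Q" using coq by (simp add: is_coq_cyc)
  have adj: "adjacent Q i j" "adjacent Q j k" using c by (auto simp: closed_walk_def)
  note v = adjacentD[OF q adj(1)] adjacentD[OF q adj(2)]
  \<comment> \<open>The vertex after \<open>k\<close> on the cycle is \<open>l\<close>, namely the
    head of \<open>D\<close>, or \<open>i\<close> for a triangle.\<close>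
  obtain l D' where l: "D @ [i] = l # D'" by (cases "D @ [i]") auto
  have rot: "circ g (j # k # l # D') = circ g (i # j # k # D)" for g
    using circ_append_commute[of g "[i]" "j # k # D"] l by simp
  have len: "length (j # k # l # D') = n" using c(2) arg_cong[OF l, of length] by simp
  have c': "closed_walk (adjacent Q) (j # k # l # D')"
    using closed_walk_append_commute[of _ "[i]" "j # k # D"] c(1) l by simp
  have kl: "adjacent Q k l" using c' by (simp add: closed_walk_def)
  have nchord: "\<not> (\<exists>d \<in> set D. d = j \<or> adjacent Q j d)"
    using circ_eq_zero_if_chord[OF assms] nz by blast
  have "\<not> (Arr Q i j \<and> Arr Q j k \<or> Arr Q k j \<and> Arr Q j i)"
    using circ_eq_zero_if_path[OF assms] nz by blast
  then have altj: "Arr Q i j \<and> Arr Q k j \<and> \<not> Arr Q j i \<and> \<not> Arr Q j k \<or>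
      Arr Q j i \<and> Arr Q j k \<and> \<not> Arr Q i j \<and> \<not> Arr Q k j"
    using adj by (auto simp: adjacent_def)
  have "\<not> (Arr Q j k \<and> Arr Q k l \<or> Arr Q l k \<and> Arr Q k j)"
    using circ_eq_zero_if_path[OF coq tp c' len] nz rot by auto
  then have altk: "Arr Q j k \<and> Arr Q l k \<or> Arr Q k j \<and> Arr Q k l"
    using adj kl by (auto simp: adjacent_def)
  have far: "d \<noteq> j" "\<not> Arr Q j d" "\<not> Arr Q d j" if "d \<in> set D" for d
    using nchord that by (auto simp: adjacent_def)
  \<comment> \<open>Off \<open>j\<close>, only \<open>i\<close> and \<open>k\<close> are neighbours
    of \<open>j\<close> on the walk, and they lie on the same side of it, so no path through
    \<open>j\<close> joins two of these vertices.\<close>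
  have keep: "Arr (mutate j Q) a b \<longleftrightarrow> Arr Q a b"
    if "a \<in> set (k # D @ [i])" "b \<in> set (k # D @ [i])" for a b
    using that far altj v arrows_mutate_unaffected[OF q, of a j b] by (auto simp: Arr_def)
  have lin: "l \<in> set (k # D @ [i])" using l by simp
  have "adjacent (mutate j Q) a b \<longleftrightarrow> adjacent Q a b"
    if "a \<in> set (k # D @ [i])" "b \<in> set (k # D @ [i])" for a b
    using keep[OF that] keep[OF that(2,1)] by (simp add: adjacent_def)
  then have "successively (adjacent (mutate j Q)) (k # D @ [i]) \<longleftrightarrow>
      successively (adjacent Q) (k # D @ [i])"
    by (intro successively_cong) auto
  then have "successively (adjacent (mutate j Q)) (k # D @ [i])"
    using c(1) by (simp add: closed_walk_def)
  moreover have "adjacent (mutate j Q) i j" "adjacent (mutate j Q) j k"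
    using adj Arr_mutate_reverse[OF q] by (auto simp: adjacent_def)
  ultimately have "closed_walk (adjacent (mutate j Q)) (i # j # k # D)"
    by (simp add: closed_walk_def)
  then have cm: "closed_walk (adjacent (mutate j Q)) (j # k # l # D')"
    using closed_walk_append_commute[of _ "[i]" "j # k # D"] l by simp
  \<comment> \<open>The mutation reverses the edge between \<open>j\<close> and \<open>k\<close> but
    keeps the one between \<open>k\<close> and \<open>l\<close>, turning the source or sink
    \<open>k\<close> into a passage.\<close>
  have pathm: "Arr (mutate j Q) j k \<and> Arr (mutate j Q) k l \<or>
      Arr (mutate j Q) l k \<and> Arr (mutate j Q) k j"
    using altk keep[OF _ lin, of k] keep[OF lin, of k] Arr_mutate_reverse[OF q] by auto
  obtain us vs where uv: "is_coq (Q, cyc (j # us @ vs))" "cohomologous Q xs (j # us @ vs)"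
    "Out_verts Q j \<subseteq> set us" "In_verts Q j \<subseteq> set vs"
    "is_coq (mutate j Q, cyc (us @ j # vs))" "totally_proper (mutate j Q, cyc (us @ j # vs))"
    using totally_proper_mutation[OF coq(1) tp(1) v(2)] by blast
  obtain us' vs' where uv': "is_coq (Q, cyc (j # us' @ vs'))" "cohomologous Q ys (j # us' @ vs')"
    "Out_verts Q j \<subseteq> set us'" "In_verts Q j \<subseteq> set vs'"
    "is_coq (mutate j Q, cyc (us' @ j # vs'))" "totally_proper (mutate j Q, cyc (us' @ j # vs'))"
    using totally_proper_mutation[OF coq(2) tp(2) v(2)] by blast
  define f where "f = diff (j # us @ vs) (j # us' @ vs')"
  define f' where "f' = diff (us @ j # vs) (us' @ j # vs')"
  have dist: "distinct (j # us @ vs)" "distinct (j # us' @ vs')" "set (us @ vs) = set (us' @ vs')"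
    using uv(1) uv'(1) by (auto simp: is_coq_cyc)
  have fj: "f i j = 0" "f j k = 0"
    using diff_Cons_eq_zero[OF dist] by (simp_all add: f_def)
  \<comment> \<open>In both lists \<open>j\<close> passes the same ones among \<open>i\<close> and
    \<open>k\<close>, so steps at \<open>j\<close> still contribute zero.\<close>
  have "a \<in> set us \<and> a \<in> set us' \<or> a \<in> set vs \<and> a \<in> set vs'" if "a = i \<or> a = k" for a
    using that altj uv(3,4) uv'(3,4) by (auto simp: In_verts_def Out_verts_def)
  then have f'j: "f' i j = 0" "f' j k = 0"
    using dist v by (auto simp: f'_def diff_def wind_def dest: before_in_set)
  have "circ (diff xs ys) (i # j # k # D) = circ f (i # j # k # D)"
    unfolding f_def using circ_cohomologous uv(2) uv'(2) c(1) by blast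
  also have "\<dots> = walk_sum f (k # D @ [i])" using fj by (simp add: circ_def)
  also have "\<dots> = walk_sum f' (k # D @ [i])"
    unfolding f_def f'_def using v far
    by (intro walk_sum_cong diff_mutation_unaffected[symmetric]) auto
  also have "\<dots> = circ f' (j # k # l # D')" using f'j rot by (simp add: circ_def)
  also have "\<dots> = 0"
    unfolding f'_def using circ_eq_zero_if_path[OF uv(5) uv'(5) uv(6) uv'(6) cm len pathm] .
  finally show False using nz by simp
qed

end

lemma totally_proper_zero_circ:
  assumes "is_coq (Q, cyc xs)" "is_coq (Q, cyc ys)"
    and "totally_proper (Q, cyc xs)" "totally_proper (Q, cyc ys)"
    and "closed_walk (adjacent Q) c"
  shows "circ (diff xs ys) c = 0"
  using assms
proof (induction "length c" arbitrary: Q xs ys c rule: less_induct)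
  case less
  \<comment> \<open>Length one would need a loop; at length two the steps cancel by
    antisymmetry.\<close>
  consider a where "c = [a]" | a b where "c = [a, b]" | i j k D where "c = i # j # k # D"
    using less.prems(5) unfolding closed_walk_def by (metis list.exhaust)
  then show ?case
  proof cases
    case 1
    then show ?thesis
      using less.prems(1,5) adjacentD(3)[of Q a a] by (auto simp: closed_walk_def is_coq_cyc)
  next
    case 2
    then show ?thesis
      using less.prems(1,2) diff_antisym[of xs ys a b] by (simp add: circ_def is_coq_cyc)
  next
    case 3
    show ?thesis
      unfolding 3
    proof (rule circ_eq_zero[of "length c"])
      fix Q' :: "'a quiver" and xs' ys' c'
      assume "is_coq (Q', cyc xs')" "is_coq (Q', cyc ys')"
        "totally_proper (Q', cyc xs')" "totally_proper (Q', cyc ys')"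
        "closed_walk (adjacent Q') c'" "length c' < length c"
      then show "circ (diff xs' ys') c' = 0" by (intro less.hyps)
    qed (use less.prems 3 in simp_all)
  qed
qed

theorem theorem14p3:
  fixes Q :: "'v quiver" and \<sigma> \<sigma>' :: "'v list set"
  assumes "is_coq (Q, \<sigma>)" and "is_coq (Q, \<sigma>')"
    and "totally_proper (Q, \<sigma>)" and "totally_proper (Q, \<sigma>')"
  shows "wiggle_equivalent (Q, \<sigma>) (Q, \<sigma>')"
proof -
  obtain xs ys where s: "\<sigma> = cyc xs" "\<sigma>' = cyc ys"
    using assms(1,2) by (auto simp: is_coq_def cyclic_ordering_def)
  have "diff xs ys a b = - diff xs ys b a" for a b
    using assms(1,2) s by (intro diff_antisym) (auto simp: is_coq_cyc)
  moreover have "circ (diff xs ys) c = 0" if "closed_walk (adjacent Q) c" for c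
    using totally_proper_zero_circ that assms s by blast
  ultimately have "cohomologous Q xs ys"
    unfolding cohomologous_def by (rule zero_circ_imp_potential[OF symp_adjacent])
  then show ?thesis using wiggle_equivalent_if_cohomologous assms s by blast
qed

end
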